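(* Let $\alpha\in\mathbb{R}\setminus\{0\}$, $\beta>0$ and let $\mathbf{X}=\mathbf{X}_s\mathrm{w}_1+\mathbf{X}_d\mathrm{w}_2\in\mathbb{T}_{\alpha\beta}^{p\times p}$. Case $\alpha<0$: Let $\{\tau_1(\lambda_{si})\}_{i=1}^p$ and $\{\tau_2(\lambda_{di})\}_{i=1}^p$ be any two permutations of the sets of eigenvalues of $\mathbf{X}_s$ and $\mathbf{X}_d$, respectively. Let $\boldsymbol\Lambda$ be the diagonal matrix whose $(i,i)$ entry is $$\lambda_i=\frac{\Re\{\lambda_s+\lambda_d\}}{2}+\frac{\Im\{\lambda_s+\lambda_d\}}{2}\mathrm{i}+\frac{\Re\{\lambda_s-\lambda_d\}}{2\sqrt\beta}\mathrm{j}+\frac{\Im\{\lambda_s-\lambda_d\}}{2\sqrt\beta}\mathrm{k},\qquad \lambda_s=\tau_1(\lambda_{si}),\ \lambda_d=\tau_2(\lambda_{di}).$$ Let $\mathbf{W}_1,\mathbf{W}_2\in\mathbb{C}_\alpha^{p\times p}$ be the matrices whose columns are eigenvectors associated with $\{\tau_1(\lambda_{si})\}$ and $\{\tau_2(\lambda_{di})\}$, and let $\mathbf{U}$ be the matrix whose columns are the corresponding eigenvectors of $\mathbf{X}$ associated with $\{\lambda_i\}_{i=1}^p$, as defined in the context. Then $\mathbf{U}^{-1}$ exists if and only if $\mathbf{W}_1^{-1}$ and $\mathbf{W}_2^{-1}$ both exist. Furthermore, if $\mathbf{U}$ is invertible, then $\mathbf{X}=\mathbf{U}\boldsymbol\Lambda\mathbf{U}^{-1}$.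 Case $\alpha>0$: Let $\{\tau_n(\theta_{ni})\}_{i=1}^p$, $n=1,\dots,4$, be any permutations of the sets of (complex) eigenvalues $\{\theta_{ni}\}_{i=1}^p$ of the real matrices $\mathbf{A}_n$ defined in the context. Let $\boldsymbol\Lambda$ be the diagonal matrix whose $(i,i)$ entry is $\lambda_i=\varphi_i+\psi_i\epsilon\in\mathbb{G}_{\alpha\beta}$, where $\varphi_i,\psi_i\in\mathbb{T}_{\alpha\beta}$ have associated $(\alpha\beta)$-tessarines $$\tilde\varphi_i=\Re\{\theta_1\}+\Re\{\theta_2\}\mathrm{i}+\Re\{\theta_3\}\mathrm{j}+\Re\{\theta_4\}\mathrm{k},\qquad \tilde\psi_i=\Im\{\theta_1\}+\Im\{\theta_2\}\mathrm{i}+\Im\{\theta_3\}\mathrm{j}+\Im\{\theta_4\}\mathrm{k},$$ with $\theta_n=\tau_n(\theta_{ni})$. Let $\mathbf{V}_n$, $n=1,\dots,4$, be the (complex) matrices whose columns are eigenvectors of $\mathbf{A}_n$ associated with $\{\tau_n(\theta_{ni})\}_{i=1}^p$, and let $\mathbf{U}$ be the matrix whose columns are the corresponding eigenvectors of $\mathbf{X}$ associated with $\{\lambda_i\}_{i=1}^p$, as defined in the context. Then $\mathbf{U}^{-1}$ exists if and only if $\mathbf{V}_n^{-1}$ exists for all $n=1,\dots,4$. Furthermore, if $\mathbf{U}$ is invertible, then $\mathbf{X}=\mathbf{U}\boldsymbol\Lambda\mathbf{U}^{-1}$.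
   Context: $\mathbb{T}_{\alpha\beta}$ (the $(\alpha\beta)$-tessarines) is the commutative, associative real algebra with basis $1,\mathrm{i},\mathrm{j},\mathrm{k}$ and multiplication $\mathrm{i}^2=\alpha$, $\mathrm{j}^2=\beta$, $\mathrm{k}^2=\alpha\beta$, $\mathrm{i}\mathrm{j}=\mathrm{k}$, $\mathrm{i}\mathrm{k}=\alpha\mathrm{j}$, $\mathrm{j}\mathrm{k}=\beta\mathrm{i}$. $\mathbb{C}_\alpha=\{a+b\mathrm{i}\}$. $\mathbb{G}_{\alpha\beta}$ (for $\alpha,\beta>0$) is the commutative algebra $\{x_1+x_2\epsilon:x_1,x_2\in\mathbb{T}_{\alpha\beta}\}$ with $\epsilon^2=-1$ and $\epsilon$ commuting with $\mathrm{i},\mathrm{j},\mathrm{k}$. $\Re$ and $\Im$ denote the real part and the coefficient of $\mathrm{i}$ for elements of $\mathbb{C}_\alpha$ (or of $\epsilon$ for complex numbers written $a+b\epsilon$). Put $\mathrm{w}_1=\frac{\sqrt\beta+\mathrm{j}}{2\sqrt\beta}$, $\mathrm{w}_2=\frac{\sqrt\beta-\mathrm{j}}{2\sqrt\beta}$. A matrix $\mathbf{X}=\mathbf{A}+\mathbf{B}\mathrm{i}+\mathbf{C}\mathrm{j}+\mathbf{D}\mathrm{k}$ with real $\mathbf{A},\mathbf{B},\mathbf{C},\mathbf{D}$ is written $\mathbf{X}=\mathbf{X}_s\mathrm{w}_1+\mathbf{X}_d\mathrm{w}_2$ with $\mathbf{X}_s=(\mathbf{A}+\mathbf{B}\mathrm{i})+\sqrt\beta(\mathbf{C}+\mathbf{D}\mathrm{i})$,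 $\mathbf{X}_d=(\mathbf{A}+\mathbf{B}\mathrm{i})-\sqrt\beta(\mathbf{C}+\mathbf{D}\mathrm{i})$. Associated tessarine ($\alpha>0$): $\tilde x=\tilde a+\tilde b\mathrm{i}+\tilde c\mathrm{j}+\tilde d\mathrm{k}$ is the associated $(\alpha\beta)$-tessarine of $x$ if $x=\frac{\tilde a+\tilde b+\tilde c+\tilde d}{4}+\frac{\tilde a-\tilde b+\tilde c-\tilde d}{4\sqrt\alpha}\mathrm{i}+\frac{\tilde a+\tilde b-\tilde c-\tilde d}{4\sqrt\beta}\mathrm{j}+\frac{\tilde a-\tilde b-\tilde c+\tilde d}{4\sqrt\alpha\sqrt\beta}\mathrm{k}$. For $\alpha>0$: $\mathbf{A}_1=\Re\{\mathbf{X}_s\}+\sqrt\alpha\,\Im\{\mathbf{X}_s\}$, $\mathbf{A}_2=\Re\{\mathbf{X}_s\}-\sqrt\alpha\,\Im\{\mathbf{X}_s\}$, $\mathbf{A}_3=\Re\{\mathbf{X}_d\}+\sqrt\alpha\,\Im\{\mathbf{X}_d\}$, $\mathbf{A}_4=\Re\{\mathbf{X}_d\}-\sqrt\alpha\,\Im\{\mathbf{X}_d\}$. Eigenvalues are listed with algebraic multiplicity ($p$ of them). For $\alpha<0$, eigenvalues and eigenvectors of an $(\alpha)$-complex matrix are taken in $\mathbb{C}_\alpha$ (which is isomorphic to the complex field via $\mathrm{i}\mapsto\sqrt{|\alpha|}\,\epsilon$). The eigenvector matrix $\mathbf{U}$ of $\mathbf{X}$: for $\alpha<0$, $\mathbf{U}=\frac{\mathbf{W}_1+\mathbf{W}_2}{2}+\frac{\mathbf{W}_1-\mathbf{W}_2}{2\sqrt\beta}\mathrm{j}$;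 for $\alpha>0$, with $\mathbf{V}_n$ having entries in $\{a+b\epsilon\}$, $\mathbf{U}=\frac{\mathbf{V}_1+\mathbf{V}_2+\mathbf{V}_3+\mathbf{V}_4}{4}+\frac{\mathbf{V}_1-\mathbf{V}_2+\mathbf{V}_3-\mathbf{V}_4}{4\sqrt\alpha}\mathrm{i}+\Big[\frac{\mathbf{V}_1+\mathbf{V}_2-\mathbf{V}_3-\mathbf{V}_4}{4\sqrt\beta}+\frac{\mathbf{V}_1-\mathbf{V}_2-\mathbf{V}_3+\mathbf{V}_4}{4\sqrt\alpha\sqrt\beta}\mathrm{i}\Big]\mathrm{j}\in\mathbb{G}_{\alpha\beta}^{p\times p}$. *)

theory Defs
  imports
    "Jordan_Normal_Form.Char_Poly"
    "HOL-Library.Product_Plus"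
    "HOL-Algebra.QuotRing"
begin

section \<open>Tessarines\<close>

text \<open>\<open>Tess a b c d\<close> stands for \<open>a + b i + c j + d k\<close>. The additive and real-linear structure
  does not depend on the parameters and is provided by type classes; the product depends on the
  real parameters \<open>\<alpha>\<close>, \<open>\<beta>\<close>, so the algebra itself is a ring record.\<close>

datatype tess = Tess (tRe: real) (tI: real) (tJ: real) (tK: real)

instantiation tess :: real_vector
begin

definition "0 = Tess 0 0 0 0"
definition "x + y = Tess (tRe x + tRe y) (tI x + tI y) (tJ x + tJ y) (tK x + tK y)"
definition "- x = Tess (- tRe x) (- tI x) (- tJ x) (- tK x)"
definition "x - y = Tess (tRe x - tRe y) (tI x - tI y) (tJ x - tJ y) (tK x - tK y)"
definition "r *\<^sub>R x = Tess (r * tRe x) (r * tI x) (r * tJ x) (r * tK x)"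

instance
  by standard
    (simp_all add: zero_tess_def plus_tess_def uminus_tess_def minus_tess_def scaleR_tess_def
      algebra_simps)

end

lemmas tess_linear_defs =
  zero_tess_def plus_tess_def uminus_tess_def minus_tess_def scaleR_tess_def

definition tone :: tess where "tone = Tess 1 0 0 0"
definition ti :: tess where "ti = Tess 0 1 0 0"
definition tj :: tess where "tj = Tess 0 0 1 0"
definition tk :: tess where "tk = Tess 0 0 0 1"

definition tmult :: "real \<Rightarrow> real \<Rightarrow> tess \<Rightarrow> tess \<Rightarrow> tess" where
  "tmult \<alpha> \<beta> x y = Tess
     (tRe x * tRe y + \<alpha> * (tI x * tI y) + \<beta> * (tJ x * tJ y) + \<alpha> * \<beta> * (tK x * tK y))
     (tRe x * tI y + tI x * tRe y + \<beta> * (tJ x * tK y + tK x * tJ y))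
     (tRe x * tJ y + tJ x * tRe y + \<alpha> * (tI x * tK y + tK x * tI y))
     (tRe x * tK y + tK x * tRe y + tI x * tJ y + tJ x * tI y)"

lemma tmult_basis:
  "tmult \<alpha> \<beta> ti ti = \<alpha> *\<^sub>R tone" "tmult \<alpha> \<beta> tj tj = \<beta> *\<^sub>R tone"
  "tmult \<alpha> \<beta> tk tk = (\<alpha> * \<beta>) *\<^sub>R tone"
  "tmult \<alpha> \<beta> ti tj = tk" "tmult \<alpha> \<beta> ti tk = \<alpha> *\<^sub>R tj" "tmult \<alpha> \<beta> tj tk = \<beta> *\<^sub>R ti"
  by (simp_all add: tmult_def tone_def ti_def tj_def tk_def scaleR_tess_def)

definition tess_ring :: "real \<Rightarrow> real \<Rightarrow> tess ring" where
  "tess_ring \<alpha> \<beta> = \<lparr>carrier = UNIV, mult = tmult \<alpha> \<beta>, one = tone, zero = 0, add = (+)\<rparr>"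

text \<open>\<open>\<complex>\<^sub>\<alpha>\<close> as a subring of the tessarines; its multiplication does not depend on \<open>\<beta>\<close>. Real part and
  imaginary part (coefficient of \<open>i\<close>) of its elements are \<open>tRe\<close> and \<open>tI\<close>.\<close>

definition acomplex_ring :: "real \<Rightarrow> real \<Rightarrow> tess ring" where
  "acomplex_ring \<alpha> \<beta> = (tess_ring \<alpha> \<beta>)\<lparr>carrier := {x. tJ x = 0 \<and> tK x = 0}\<rparr>"

text \<open>For \<open>\<alpha> < 0\<close>, the isomorphism of \<open>\<complex>\<^sub>\<alpha>\<close> with the complex field sending \<open>i\<close> to
  \<open>sqrt \<bar>\<alpha>\<bar>\<close> times the imaginary unit.\<close>

definition acomplex_to_complex :: "real \<Rightarrow> tess \<Rightarrow> complex" where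
  "acomplex_to_complex \<alpha> z = Complex (tRe z) (sqrt \<bar>\<alpha>\<bar> * tI z)"

text \<open>The algebra \<open>\<bbbG>\<^sub>\<alpha>\<^sub>\<beta>\<close>: the pair \<open>(x\<^sub>1, x\<^sub>2)\<close> stands for \<open>x\<^sub>1 + x\<^sub>2 \<epsilon>\<close>, where \<open>\<epsilon>\<^sup>2 = - 1\<close>.\<close>

type_synonym gtess = "tess \<times> tess"

definition gmult :: "real \<Rightarrow> real \<Rightarrow> gtess \<Rightarrow> gtess \<Rightarrow> gtess" where
  "gmult \<alpha> \<beta> x y =
     (tmult \<alpha> \<beta> (fst x) (fst y) - tmult \<alpha> \<beta> (snd x) (snd y),
      tmult \<alpha> \<beta> (fst x) (snd y) + tmult \<alpha> \<beta> (snd x) (fst y))"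

definition gtess_ring :: "real \<Rightarrow> real \<Rightarrow> gtess ring" where
  "gtess_ring \<alpha> \<beta> =
     \<lparr>carrier = UNIV, mult = gmult \<alpha> \<beta>, one = (tone, 0), zero = 0, add = (+)\<rparr>"

definition g_of_tess :: "tess \<Rightarrow> gtess" where
  "g_of_tess x = (x, 0)"

text \<open>The numbers \<open>a + b \<epsilon>\<close> with \<open>a\<close>, \<open>b\<close> real are represented by the type \<^typ>\<open>complex\<close>.\<close>

definition g_of_complex :: "complex \<Rightarrow> gtess" where
  "g_of_complex z = (Re z *\<^sub>R tone, Im z *\<^sub>R tone)"

definition is_associated_tess :: "real \<Rightarrow> real \<Rightarrow> tess \<Rightarrow> tess \<Rightarrow> bool" where
  "is_associated_tess \<alpha> \<beta> xt x \<longleftrightarrow>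
     (case xt of Tess a b c d \<Rightarrow>
        x = Tess ((a + b + c + d) / 4)
                 ((a - b + c - d) / (4 * sqrt \<alpha>))
                 ((a + b - c - d) / (4 * sqrt \<beta>))
                 ((a - b - c + d) / (4 * sqrt \<alpha> * sqrt \<beta>)))"

lemma cring_tess_ring: "cring (tess_ring \<alpha> \<beta>)"
proof (rule cringI)
  show "abelian_group (tess_ring \<alpha> \<beta>)"
  proof (rule abelian_groupI)
    fix x assume "x \<in> carrier (tess_ring \<alpha> \<beta>)"
    show "\<exists>y\<in>carrier (tess_ring \<alpha> \<beta>). y \<oplus>\<^bsub>tess_ring \<alpha> \<beta>\<^esub> x = \<zero>\<^bsub>tess_ring \<alpha> \<beta>\<^esub>"
      by (rule bexI[of _ "- x"]) (auto simp: tess_ring_def)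
  qed (auto simp: tess_ring_def algebra_simps)
  show "comm_monoid (tess_ring \<alpha> \<beta>)"
    by (rule comm_monoidI) (auto simp: tess_ring_def tmult_def tone_def algebra_simps)
qed (auto simp: tess_ring_def tmult_def plus_tess_def algebra_simps)

lemma cring_gtess_ring: "cring (gtess_ring \<alpha> \<beta>)"
proof (rule cringI)
  show "abelian_group (gtess_ring \<alpha> \<beta>)"
  proof (rule abelian_groupI)
    fix x assume "x \<in> carrier (gtess_ring \<alpha> \<beta>)"
    show "\<exists>y\<in>carrier (gtess_ring \<alpha> \<beta>). y \<oplus>\<^bsub>gtess_ring \<alpha> \<beta>\<^esub> x = \<zero>\<^bsub>gtess_ring \<alpha> \<beta>\<^esub>"
      by (rule bexI[of _ "- x"]) (auto simp: gtess_ring_def)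
  qed (auto simp: gtess_ring_def algebra_simps)
  show "comm_monoid (gtess_ring \<alpha> \<beta>)"
    by (rule comm_monoidI)
      (auto simp: gtess_ring_def gmult_def tmult_def tone_def tess_linear_defs algebra_simps)
qed (auto simp: gtess_ring_def gmult_def tmult_def tess_linear_defs algebra_simps)

lemma acomplex_to_complex_iso:
  assumes "\<alpha> < 0"
  shows "acomplex_to_complex \<alpha> \<in> ring_iso (acomplex_ring \<alpha> \<beta>)
           \<lparr>carrier = UNIV, mult = (*), one = 1, zero = 0, add = (+)\<rparr>"
proof -
  have sq: "sqrt \<bar>\<alpha>\<bar> * sqrt \<bar>\<alpha>\<bar> = - \<alpha>" "sqrt \<bar>\<alpha>\<bar> \<noteq> 0" using assms by auto
  have "bij_betw (acomplex_to_complex \<alpha>) {x. tJ x = 0 \<and> tK x = 0} UNIV"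
    by (rule bij_betw_byWitness[where f' = "\<lambda>z. Tess (Re z) (Im z / sqrt \<bar>\<alpha>\<bar>) 0 0"])
      (use assms in \<open>auto simp: acomplex_to_complex_def tess.expand\<close>)
  moreover have "(sqrt \<bar>\<alpha>\<bar> * x) * (sqrt \<bar>\<alpha>\<bar> * y) = - \<alpha> * (x * y)" for x y
    using sq(1) by (metis mult.assoc mult.left_commute)
  ultimately show ?thesis
    by (intro ring_iso_memI)
      (auto simp: acomplex_ring_def tess_ring_def acomplex_to_complex_def tmult_def tone_def
        plus_tess_def complex_eq_iff algebra_simps)
qed

section \<open>Matrices over a ring record\<close>

definition matrix_ring :: "('a, 'm) ring_scheme \<Rightarrow> nat \<Rightarrow> 'a mat ring" where
  "matrix_ring R n =
     \<lparr>carrier = {A \<in> carrier_mat n n. elements_mat A \<subseteq> carrier R},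
      mult = \<lambda>A B. mat n n (\<lambda>(i, j). \<Oplus>\<^bsub>R\<^esub>k\<in>{..<n}. A $$ (i, k) \<otimes>\<^bsub>R\<^esub> B $$ (k, j)),
      one = mat n n (\<lambda>(i, j). if i = j then \<one>\<^bsub>R\<^esub> else \<zero>\<^bsub>R\<^esub>),
      zero = mat n n (\<lambda>(i, j). \<zero>\<^bsub>R\<^esub>),
      add = \<lambda>A B. mat n n (\<lambda>(i, j). A $$ (i, j) \<oplus>\<^bsub>R\<^esub> B $$ (i, j))\<rparr>"

definition diagonal_over :: "('a, 'm) ring_scheme \<Rightarrow> nat \<Rightarrow> (nat \<Rightarrow> 'a) \<Rightarrow> 'a mat" where
  "diagonal_over R n d = mat n n (\<lambda>(i, j). if i = j then d i else \<zero>\<^bsub>R\<^esub>)"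

definition eigenvector_over ::
  "('a, 'm) ring_scheme \<Rightarrow> nat \<Rightarrow> 'a mat \<Rightarrow> 'a vec \<Rightarrow> 'a \<Rightarrow> bool" where
  "eigenvector_over R n A v c \<longleftrightarrow>
     v \<in> carrier_vec n \<and> (\<forall>i<n. v $ i \<in> carrier R) \<and> (\<exists>i<n. v $ i \<noteq> \<zero>\<^bsub>R\<^esub>) \<and>
     (\<forall>i<n. (\<Oplus>\<^bsub>R\<^esub>k\<in>{..<n}. A $$ (i, k) \<otimes>\<^bsub>R\<^esub> v $ k) = c \<otimes>\<^bsub>R\<^esub> v $ i)"

text \<open>\<open>l 0, \<dots>, l (n - 1)\<close> lists the eigenvalues with algebraic multiplicity. For matrices over
  \<open>\<complex>\<^sub>\<alpha>\<close> (with \<open>\<alpha> < 0\<close>), multiplicities are read off the characteristic polynomial of the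
  isomorphic complex matrix.\<close>

definition is_eigenvalue_list :: "nat \<Rightarrow> complex mat \<Rightarrow> (nat \<Rightarrow> complex) \<Rightarrow> bool" where
  "is_eigenvalue_list n A l \<longleftrightarrow> char_poly A = (\<Prod>i<n. [:- l i, 1:])"

definition is_acomplex_eigenvalue_list ::
  "real \<Rightarrow> real \<Rightarrow> nat \<Rightarrow> tess mat \<Rightarrow> (nat \<Rightarrow> tess) \<Rightarrow> bool" where
  "is_acomplex_eigenvalue_list \<alpha> \<beta> n A l \<longleftrightarrow>
     (\<forall>i<n. l i \<in> carrier (acomplex_ring \<alpha> \<beta>)) \<and>
     is_eigenvalue_list n (map_mat (acomplex_to_complex \<alpha>) A) (\<lambda>i. acomplex_to_complex \<alpha> (l i))"

section \<open>Components of a tessarine matrix\<close>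

definition mat_s :: "real \<Rightarrow> tess mat \<Rightarrow> tess mat" where
  "mat_s \<beta> X =
     map_mat (\<lambda>x. Tess (tRe x) (tI x) 0 0 + sqrt \<beta> *\<^sub>R Tess (tJ x) (tK x) 0 0) X"

definition mat_d :: "real \<Rightarrow> tess mat \<Rightarrow> tess mat" where
  "mat_d \<beta> X =
     map_mat (\<lambda>x. Tess (tRe x) (tI x) 0 0 - sqrt \<beta> *\<^sub>R Tess (tJ x) (tK x) 0 0) X"

definition w1 :: "real \<Rightarrow> tess" where
  "w1 \<beta> = (1 / (2 * sqrt \<beta>)) *\<^sub>R (sqrt \<beta> *\<^sub>R tone + tj)"

definition w2 :: "real \<Rightarrow> tess" where
  "w2 \<beta> = (1 / (2 * sqrt \<beta>)) *\<^sub>R (sqrt \<beta> *\<^sub>R tone - tj)"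

lemma mat_s_mat_d_decomposition:
  assumes "\<beta> > 0" "X \<in> carrier_mat p p"
  shows "X = mat p p (\<lambda>ij. tmult \<alpha> \<beta> (mat_s \<beta> X $$ ij) (w1 \<beta>) + tmult \<alpha> \<beta> (mat_d \<beta> X $$ ij) (w2 \<beta>))"
proof (rule eq_matI)
  fix i j
  assume ij: "i < dim_row (mat p p (\<lambda>ij. tmult \<alpha> \<beta> (mat_s \<beta> X $$ ij) (w1 \<beta>)
      + tmult \<alpha> \<beta> (mat_d \<beta> X $$ ij) (w2 \<beta>)))"
    "j < dim_col (mat p p (\<lambda>ij. tmult \<alpha> \<beta> (mat_s \<beta> X $$ ij) (w1 \<beta>)
      + tmult \<alpha> \<beta> (mat_d \<beta> X $$ ij) (w2 \<beta>)))"
  obtain a b c d where x: "X $$ (i, j) = Tess a b c d" by (cases "X $$ (i, j)")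
  show "X $$ (i, j) = mat p p (\<lambda>ij. tmult \<alpha> \<beta> (mat_s \<beta> X $$ ij) (w1 \<beta>)
      + tmult \<alpha> \<beta> (mat_d \<beta> X $$ ij) (w2 \<beta>)) $$ (i, j)"
    using ij assms
    by (simp add: x mat_s_def mat_d_def w1_def w2_def tmult_def tone_def tj_def tess_linear_defs
        field_simps)
qed (use assms in auto)

definition mat_A :: "real \<Rightarrow> real \<Rightarrow> tess mat \<Rightarrow> nat \<Rightarrow> real mat" where
  "mat_A \<alpha> \<beta> X n =
    (if n = 1 then map_mat (\<lambda>x. tRe x + sqrt \<alpha> * tI x) (mat_s \<beta> X)
     else if n = 2 then map_mat (\<lambda>x. tRe x - sqrt \<alpha> * tI x) (mat_s \<beta> X)
     else if n = 3 then map_mat (\<lambda>x. tRe x + sqrt \<alpha> * tI x) (mat_d \<beta> X)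
     else map_mat (\<lambda>x. tRe x - sqrt \<alpha> * tI x) (mat_d \<beta> X))"

section \<open>Eigenvalues and the eigenvector matrix\<close>

definition lambda_neg :: "real \<Rightarrow> tess \<Rightarrow> tess \<Rightarrow> tess" where
  "lambda_neg \<beta> ls ld =
     Tess (tRe (ls + ld) / 2) (tI (ls + ld) / 2)
          (tRe (ls - ld) / (2 * sqrt \<beta>)) (tI (ls - ld) / (2 * sqrt \<beta>))"

definition U_neg :: "real \<Rightarrow> real \<Rightarrow> nat \<Rightarrow> tess mat \<Rightarrow> tess mat \<Rightarrow> tess mat" where
  "U_neg \<alpha> \<beta> p W1 W2 = mat p p (\<lambda>ij.
     (1 / 2) *\<^sub>R (W1 $$ ij + W2 $$ ij) +
     tmult \<alpha> \<beta> ((1 / (2 * sqrt \<beta>)) *\<^sub>R (W1 $$ ij - W2 $$ ij)) tj)"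

definition U_pos :: "real \<Rightarrow> real \<Rightarrow> nat \<Rightarrow> (nat \<Rightarrow> complex mat) \<Rightarrow> gtess mat" where
  "U_pos \<alpha> \<beta> p V = mat p p (\<lambda>ij.
     let v1 = V 1 $$ ij; v2 = V 2 $$ ij; v3 = V 3 $$ ij; v4 = V 4 $$ ij in
       (g_of_complex ((v1 + v2 + v3 + v4) / 4)
        + gmult \<alpha> \<beta> (g_of_complex ((v1 - v2 + v3 - v4) / (4 * sqrt \<alpha>))) (g_of_tess ti))
       + gmult \<alpha> \<beta>
          (g_of_complex ((v1 + v2 - v3 - v4) / (4 * sqrt \<beta>))
           + gmult \<alpha> \<beta> (g_of_complex ((v1 - v2 - v3 + v4) / (4 * sqrt \<alpha> * sqrt \<beta>)))
               (g_of_tess ti))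
          (g_of_tess tj))"

end

theory Submission imports Defs begin

text \<open>The tessarines for \<open>\<alpha> < 0 < \<beta>\<close> and \<open>\<bbbG>\<^sub>\<alpha>\<^sub>\<beta>\<close> for \<open>\<alpha>, \<beta> > 0\<close> are products of two and of four
  copies of the complex field, respectively.
  Matrices over such a product can be multiplied, inverted and compared one factor at a time, and
  the matrices \<open>U\<close> and \<open>\<Lambda>\<close> are built so that the factors of \<open>U\<close> are the given eigenvector
  matrices and those of \<open>\<Lambda>\<close> the corresponding diagonal matrices of eigenvalues. Hence
  \<open>X U = U \<Lambda>\<close> holds because it holds in every factor, whether or not \<open>U\<close> is invertible.\<close>

section \<open>Matrices over a product of commutative rings\<close>

text \<open>The maps \<open>f n\<close> with \<open>n\<close> in \<open>I\<close> identify
  \<open>R\<close> with a product of copies of one commutative ring: \<open>f_inj\<close> and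
  \<open>f_surj\<close> say that together they form a bijection. The factors live in a type class,
  so type-class matrices can be used there while \<open>R\<close> stays a ring record.\<close>

locale split_ring = cring R for R (structure) +
  fixes I :: "'i set" and f :: "'i \<Rightarrow> 'a \<Rightarrow> 'b::comm_ring_1"
  assumes f_add: "\<lbrakk>n \<in> I; x \<in> carrier R; y \<in> carrier R\<rbrakk> \<Longrightarrow> f n (x \<oplus> y) = f n x + f n y"
    and f_mult: "\<lbrakk>n \<in> I; x \<in> carrier R; y \<in> carrier R\<rbrakk> \<Longrightarrow> f n (x \<otimes> y) = f n x * f n y"
    and f_one: "n \<in> I \<Longrightarrow> f n \<one> = 1"
    and f_inj: "\<lbrakk>x \<in> carrier R; y \<in> carrier R; \<And>n. n \<in> I \<Longrightarrow> f n x = f n y\<rbrakk> \<Longrightarrow> x = y"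
    and f_surj: "\<exists>x\<in>carrier R. \<forall>n\<in>I. f n x = z n"
begin

lemma f_zero: "n \<in> I \<Longrightarrow> f n \<zero> = 0"
  using f_add[of n \<zero> \<zero>] by simp

lemma f_finsum:
  assumes "n \<in> I" "finite S" "g \<in> S \<rightarrow> carrier R"
  shows "f n (\<Oplus>k\<in>S. g k) = (\<Sum>k\<in>S. f n (g k))"
  using assms(2,3)
proof (induction S)
  case (insert a S)
  then have "g \<in> S \<rightarrow> carrier R" "g a \<in> carrier R" by auto
  with insert show ?case using assms(1) by (simp add: f_add)
qed (simp add: f_zero assms)

lemma matrix_ring_carrier_iff:
  "A \<in> carrier (matrix_ring R p) \<longleftrightarrow>
     A \<in> carrier_mat p p \<and> (\<forall>i<p. \<forall>j<p. A $$ (i, j) \<in> carrier R)"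
  by (fastforce simp: matrix_ring_def elements_mat_def)

lemma matrix_ring_mult_closed:
  assumes "A \<in> carrier (matrix_ring R p)" "B \<in> carrier (matrix_ring R p)"
  shows "A \<otimes>\<^bsub>matrix_ring R p\<^esub> B \<in> carrier (matrix_ring R p)"
  using assms unfolding matrix_ring_carrier_iff
  by (auto simp: matrix_ring_def intro!: finsum_closed)

lemma matrix_ring_one_closed: "\<one>\<^bsub>matrix_ring R p\<^esub> \<in> carrier (matrix_ring R p)"
  unfolding matrix_ring_carrier_iff by (auto simp: matrix_ring_def)

lemma map_mat_mult:
  assumes "n \<in> I" "A \<in> carrier (matrix_ring R p)" "B \<in> carrier (matrix_ring R p)"
  shows "map_mat (f n) (A \<otimes>\<^bsub>matrix_ring R p\<^esub> B) = map_mat (f n) A * map_mat (f n) B"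
  using assms unfolding matrix_ring_carrier_iff
  by (intro eq_matI)
    (auto simp: matrix_ring_def f_finsum f_mult Pi_def scalar_prod_def lessThan_atLeast0)

lemma map_mat_one: "n \<in> I \<Longrightarrow> map_mat (f n) (\<one>\<^bsub>matrix_ring R p\<^esub>) = 1\<^sub>m p"
  by (intro eq_matI) (auto simp: matrix_ring_def f_one f_zero)

lemma map_mat_diagonal_over:
  "n \<in> I \<Longrightarrow> map_mat (f n) (diagonal_over R p d) = mat_diag p (\<lambda>i. f n (d i))"
  by (intro eq_matI) (auto simp: diagonal_over_def mat_diag_def f_zero)

lemma diagonal_over_closed:
  "(\<And>i. i < p \<Longrightarrow> d i \<in> carrier R) \<Longrightarrow> diagonal_over R p d \<in> carrier (matrix_ring R p)"
  unfolding matrix_ring_carrier_iff by (auto simp: diagonal_over_def)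

text \<open>This is \<open>f_inj\<close> applied entrywise; it reduces matrix identities over
  \<open>R\<close> to identities between type-class matrices over the factors.\<close>

lemma matrix_ring_eqI:
  assumes "A \<in> carrier (matrix_ring R p)" "B \<in> carrier (matrix_ring R p)"
    and eq: "\<And>n. n \<in> I \<Longrightarrow> map_mat (f n) A = map_mat (f n) B"
  shows "A = B"
proof (rule eq_matI)
  fix i j assume "i < dim_row B" "j < dim_col B"
  then have ij: "i < p" "j < p" using assms(2) by (auto simp: matrix_ring_carrier_iff)
  show "A $$ (i, j) = B $$ (i, j)"
  proof (rule f_inj)
    fix n assume "n \<in> I"
    from arg_cong[OF eq[OF this], of "\<lambda>M. M $$ (i, j)"]
    show "f n (A $$ (i, j)) = f n (B $$ (i, j))"
      using ij assms(1,2) by (auto simp: matrix_ring_carrier_iff)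
  qed (use ij assms(1,2) in \<open>auto simp: matrix_ring_carrier_iff\<close>)
qed (use assms(1,2) in \<open>auto simp: matrix_ring_carrier_iff\<close>)

lemma matrix_ring_lift:
  assumes "\<And>n. n \<in> I \<Longrightarrow> B n \<in> carrier_mat p p"
  obtains A where "A \<in> carrier (matrix_ring R p)" "\<And>n. n \<in> I \<Longrightarrow> map_mat (f n) A = B n"
proof -
  \<comment> \<open>\<open>g\<close> picks one simultaneous preimage for each family
    \<open>z\<close>; used at every position, it glues the matrices \<open>B n\<close>
    together.\<close>
  obtain g where g: "\<And>z. g z \<in> carrier R" "\<And>z n. n \<in> I \<Longrightarrow> f n (g z) = z n"
    using f_surj by metis
  show ?thesis
  proof (rule that)
    show "mat p p (\<lambda>ij. g (\<lambda>n. B n $$ ij)) \<in> carrier (matrix_ring R p)"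
      unfolding matrix_ring_carrier_iff by (auto simp: g)
    show "map_mat (f n) (mat p p (\<lambda>ij. g (\<lambda>n. B n $$ ij))) = B n" if "n \<in> I" for n
      using assms[OF that] that by (intro eq_matI) (auto simp: g)
  qed
qed

lemma map_mat_closed:
  "A \<in> carrier (matrix_ring R p) \<Longrightarrow> map_mat (f n) A \<in> carrier_mat p p"
  by (simp add: matrix_ring_carrier_iff)

text \<open>The laws are pulled back from the factors, without rearranging any
  \<open>finsum\<close>. They make the theory of \<open>Units\<close> and \<open>inv\<close>
  available.\<close>

lemma monoid_matrix_ring: "monoid (matrix_ring R p)"
proof (rule monoidI)
  fix A B C
  assume *: "A \<in> carrier (matrix_ring R p)" "B \<in> carrier (matrix_ring R p)"
    "C \<in> carrier (matrix_ring R p)"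
  show "A \<otimes>\<^bsub>matrix_ring R p\<^esub> B \<otimes>\<^bsub>matrix_ring R p\<^esub> C
      = A \<otimes>\<^bsub>matrix_ring R p\<^esub> (B \<otimes>\<^bsub>matrix_ring R p\<^esub> C)"
    by (rule matrix_ring_eqI[of _ p])
      (use * in \<open>auto simp: map_mat_mult matrix_ring_mult_closed
        intro!: assoc_mult_mat map_mat_closed\<close>)
next
  fix A assume *: "A \<in> carrier (matrix_ring R p)"
  show "\<one>\<^bsub>matrix_ring R p\<^esub> \<otimes>\<^bsub>matrix_ring R p\<^esub> A = A"
    by (rule matrix_ring_eqI[of _ p])
      (use * in \<open>auto simp: map_mat_mult map_mat_one matrix_ring_mult_closed
        matrix_ring_one_closed intro!: left_mult_one_mat map_mat_closed\<close>)
  show "A \<otimes>\<^bsub>matrix_ring R p\<^esub> \<one>\<^bsub>matrix_ring R p\<^esub> = A"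
    by (rule matrix_ring_eqI[of _ p])
      (use * in \<open>auto simp: map_mat_mult map_mat_one matrix_ring_mult_closed
        matrix_ring_one_closed intro!: right_mult_one_mat map_mat_closed\<close>)
qed (auto simp: matrix_ring_mult_closed matrix_ring_one_closed)

text \<open>A two-sided inverse maps to two-sided inverses in the factors. Conversely, inverses
  chosen in the factors lift to one matrix, which is an inverse because it is one in every
  factor.\<close>

lemma matrix_ring_Units_iff:
  assumes A: "A \<in> carrier (matrix_ring R p)"
  shows "A \<in> Units (matrix_ring R p) \<longleftrightarrow> (\<forall>n\<in>I. invertible_mat (map_mat (f n) A))"
proof
  assume "A \<in> Units (matrix_ring R p)"
  then obtain B where B: "B \<in> carrier (matrix_ring R p)"
    "B \<otimes>\<^bsub>matrix_ring R p\<^esub> A = \<one>\<^bsub>matrix_ring R p\<^esub>"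
    "A \<otimes>\<^bsub>matrix_ring R p\<^esub> B = \<one>\<^bsub>matrix_ring R p\<^esub>"
    by (auto simp: Units_def)
  have "inverts_mat (map_mat (f n) A) (map_mat (f n) B)"
    "inverts_mat (map_mat (f n) B) (map_mat (f n) A)" if "n \<in> I" for n
    using that A B by (auto simp: inverts_mat_def matrix_ring_carrier_iff map_mat_one
      map_mat_mult[symmetric, OF that A B(1)] map_mat_mult[symmetric, OF that B(1) A])
  then show "\<forall>n\<in>I. invertible_mat (map_mat (f n) A)"
    using A by (auto simp: invertible_mat_def matrix_ring_carrier_iff)
next
  assume inv: "\<forall>n\<in>I. invertible_mat (map_mat (f n) A)"
  have "\<exists>B. B \<in> carrier_mat p p \<and> map_mat (f n) A * B = 1\<^sub>m p \<and> B * map_mat (f n) A = 1\<^sub>m p"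
    if n: "n \<in> I" for n
  proof -
    obtain B where B: "map_mat (f n) A * B = 1\<^sub>m (dim_row A)"
      "B * map_mat (f n) A = 1\<^sub>m (dim_row B)"
      using inv n by (auto simp: invertible_mat_def inverts_mat_def)
    \<comment> \<open>\<open>invertible_mat\<close> does not state the shape of the inverse; it
      follows by comparing column counts in the two product equations.\<close>
    have "dim_col B = p" "dim_row B = p"
      using arg_cong[OF B(1), of dim_col] arg_cong[OF B(2), of dim_col] A
      by (auto simp: matrix_ring_carrier_iff)
    then show ?thesis using A B by (auto simp: matrix_ring_carrier_iff)
  qed
  then obtain B where B: "\<And>n. n \<in> I \<Longrightarrow> B n \<in> carrier_mat p p"
    "\<And>n. n \<in> I \<Longrightarrow> map_mat (f n) A * B n = 1\<^sub>m p" "\<And>n. n \<in> I \<Longrightarrow> B n * map_mat (f n) A = 1\<^sub>m p"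
    by metis
  obtain C where C: "C \<in> carrier (matrix_ring R p)" "\<And>n. n \<in> I \<Longrightarrow> map_mat (f n) C = B n"
    using matrix_ring_lift[of B p] B(1) by blast
  have "C \<otimes>\<^bsub>matrix_ring R p\<^esub> A = \<one>\<^bsub>matrix_ring R p\<^esub>"
    "A \<otimes>\<^bsub>matrix_ring R p\<^esub> C = \<one>\<^bsub>matrix_ring R p\<^esub>"
    by ((rule matrix_ring_eqI[of _ p],
        simp_all add: A B C map_mat_mult map_mat_one matrix_ring_mult_closed
          matrix_ring_one_closed)[1])+
  then show "A \<in> Units (matrix_ring R p)" using A C(1) by (auto simp: Units_def)
qed

text \<open>By \<open>eq\<close>, \<open>U\<close> intertwines \<open>X\<close> with the diagonal
  matrix in each factor, hence over \<open>R\<close>; multiplying by the inverse of \<open>U\<close>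
  on the right gives the claim.\<close>

lemma matrix_ring_diagonalization:
  assumes X: "X \<in> carrier (matrix_ring R p)" and U: "U \<in> Units (matrix_ring R p)"
    and d: "\<And>i. i < p \<Longrightarrow> d i \<in> carrier R"
    and eq: "\<And>n. n \<in> I \<Longrightarrow>
      map_mat (f n) X * map_mat (f n) U = map_mat (f n) U * mat_diag p (\<lambda>i. f n (d i))"
  shows "X = U \<otimes>\<^bsub>matrix_ring R p\<^esub> diagonal_over R p d \<otimes>\<^bsub>matrix_ring R p\<^esub> inv\<^bsub>matrix_ring R p\<^esub> U"
proof -
  interpret M: monoid "matrix_ring R p" by (rule monoid_matrix_ring)
  have "X \<otimes>\<^bsub>matrix_ring R p\<^esub> U = U \<otimes>\<^bsub>matrix_ring R p\<^esub> diagonal_over R p d"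
    by (rule matrix_ring_eqI[of _ p])
      (use X U d eq in \<open>simp_all add: M.Units_closed map_mat_mult matrix_ring_mult_closed
        map_mat_diagonal_over diagonal_over_closed\<close>)
  then show ?thesis using X U
    by (metis M.Units_closed M.Units_inv_closed M.Units_r_inv M.m_assoc M.r_one)
qed

text \<open>A homomorphism preserves the eigenvector equation. Only the equation passes to the
  factor: in a product, a nonzero vector may have a zero component.\<close>

lemma map_eigenvector_over:
  assumes n: "n \<in> I" and A: "A \<in> carrier (matrix_ring R p)" and c: "c \<in> carrier R"
    and v: "eigenvector_over R p A v c"
  shows "map_mat (f n) A *\<^sub>v map_vec (f n) v = f n c \<cdot>\<^sub>v map_vec (f n) v"
proof (rule eq_vecI)
  fix i assume "i < dim_vec (f n c \<cdot>\<^sub>v map_vec (f n) v)"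
  then have i: "i < p" using v by (auto simp: eigenvector_over_def)
  have v': "dim_vec v = p" "\<And>k. k < p \<Longrightarrow> v $ k \<in> carrier R"
    using v by (auto simp: eigenvector_over_def)
  have "(\<Sum>k<p. f n (A $$ (i, k)) * f n (v $ k)) = f n (\<Oplus>k\<in>{..<p}. A $$ (i, k) \<otimes> v $ k)"
    using i n A v' by (simp add: matrix_ring_carrier_iff f_finsum f_mult Pi_def)
  also have "\<dots> = f n (c \<otimes> v $ i)"
    using v i by (simp add: eigenvector_over_def)
  finally have "(\<Sum>k<p. f n (A $$ (i, k)) * f n (v $ k)) = f n c * f n (v $ i)"
    using i n c v' by (simp add: f_mult)
  then show "(map_mat (f n) A *\<^sub>v map_vec (f n) v) $ i = (f n c \<cdot>\<^sub>v map_vec (f n) v) $ i"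
    using i A v' by (auto simp: matrix_ring_carrier_iff scalar_prod_def lessThan_atLeast0)
qed (use A v in \<open>auto simp: eigenvector_over_def matrix_ring_carrier_iff\<close>)

end

text \<open>Column \<open>j\<close> of \<open>A * V\<close> is \<open>A *\<^sub>v col V j\<close>,
  and right multiplication by a diagonal matrix scales column \<open>j\<close> by
  \<open>l j\<close>.\<close>

lemma mult_mat_eigenvector_columns:
  assumes "A \<in> carrier_mat p p" "V \<in> carrier_mat p p"
    and "\<And>i. i < p \<Longrightarrow> A *\<^sub>v col V i = l i \<cdot>\<^sub>v col V i"
  shows "A * V = V * mat_diag p (l :: nat \<Rightarrow> 'a::comm_ring_1)"
proof (rule eq_matI)
  fix i j assume "i < dim_row (V * mat_diag p l)" "j < dim_col (V * mat_diag p l)"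
  then have ij: "i < p" "j < p" using assms by (auto simp: mat_diag_def)
  have "(A * V) $$ (i, j) = (A *\<^sub>v col V j) $ i" using ij assms(1,2) by auto
  also have "\<dots> = (V * mat_diag p l) $$ (i, j)"
    using ij assms by (simp add: mat_diag_mult_right[OF assms(2)] ac_simps)
  finally show "(A * V) $$ (i, j) = (V * mat_diag p l) $$ (i, j)" .
qed (use assms in \<open>auto simp: mat_diag_def\<close>)

section \<open>The splittings\<close>

lemma cring_acomplex_ring: "cring (acomplex_ring \<alpha> \<beta>)"
proof (rule cringI)
  show "abelian_group (acomplex_ring \<alpha> \<beta>)"
  proof (rule abelian_groupI)
    fix x assume "x \<in> carrier (acomplex_ring \<alpha> \<beta>)"
    then show "\<exists>y\<in>carrier (acomplex_ring \<alpha> \<beta>).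
        y \<oplus>\<^bsub>acomplex_ring \<alpha> \<beta>\<^esub> x = \<zero>\<^bsub>acomplex_ring \<alpha> \<beta>\<^esub>"
      by (intro bexI[of _ "- x"]) (auto simp: acomplex_ring_def tess_ring_def tess_linear_defs)
  qed (auto simp: acomplex_ring_def tess_ring_def tess_linear_defs algebra_simps tess.expand)
  show "comm_monoid (acomplex_ring \<alpha> \<beta>)"
    by (rule comm_monoidI)
      (auto simp: acomplex_ring_def tess_ring_def tmult_def tone_def algebra_simps tess.expand)
qed (auto simp: acomplex_ring_def tess_ring_def tmult_def tess_linear_defs algebra_simps)

text \<open>The case of a single factor, indexed by \<open>unit\<close>. It carries invertibility
  and eigenvector equations over \<open>acomplex_ring\<close> to ordinary complex matrices.\<close>

lemma split_acomplex_ring: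
  assumes "\<alpha> < 0"
  shows "split_ring (acomplex_ring \<alpha> \<beta>) UNIV (\<lambda>_::unit. acomplex_to_complex \<alpha>)"
proof -
  note iso = acomplex_to_complex_iso[OF assms, of \<beta>]
  have bij: "bij_betw (acomplex_to_complex \<alpha>) (carrier (acomplex_ring \<alpha> \<beta>)) UNIV"
    using iso by (auto simp: ring_iso_def)
  show ?thesis
    by (intro split_ring.intro cring_acomplex_ring split_ring_axioms.intro)
      (use iso bij in \<open>auto simp: ring_iso_def ring_hom_def bij_betw_def inj_on_def\<close>,
        metis UNIV_I imageE)
qed

text \<open>The sign \<open>\<sigma>\<close> is the image of \<open>j / sqrt \<beta>\<close>.\<close>

definition tess_to_complex :: "real \<Rightarrow> real \<Rightarrow> real \<Rightarrow> tess \<Rightarrow> complex" where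
  "tess_to_complex \<alpha> \<beta> \<sigma> x = acomplex_to_complex \<alpha>
     (Tess (tRe x + \<sigma> * sqrt \<beta> * tJ x) (tI x + \<sigma> * sqrt \<beta> * tK x) 0 0)"

text \<open>For \<sigma> = 1 or -1, sending j to \<sigma> times the root of \<beta> respects the
  square of j, and i goes to a complex root of \<alpha>. The sum and the difference of the two
  images determine the element, which gives bijectivity.\<close>

lemma split_tess_ring:
  assumes "\<alpha> < 0" "\<beta> > 0"
  shows "split_ring (tess_ring \<alpha> \<beta>) {1, - 1} (tess_to_complex \<alpha> \<beta>)"
proof (intro split_ring.intro cring_tess_ring split_ring_axioms.intro)
  define a b where "a = sqrt \<bar>\<alpha>\<bar>" and "b = sqrt \<beta>"
  \<comment> \<open>Expressing the parameters through squares makes multiplicativity a polynomial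
    identity in \<open>a\<close> and \<open>b\<close>.\<close>
  have a: "\<alpha> = - (a * a)" "a \<noteq> 0" "\<bar>a\<bar> = a" and b: "\<beta> = b * b" "b \<noteq> 0" "\<bar>b\<bar> = b"
    using assms by (auto simp: a_def b_def)
  note defs = tess_to_complex_def acomplex_to_complex_def a_def[symmetric] b_def[symmetric]
  show "tess_to_complex \<alpha> \<beta> \<sigma> (x \<oplus>\<^bsub>tess_ring \<alpha> \<beta>\<^esub> y)
      = tess_to_complex \<alpha> \<beta> \<sigma> x + tess_to_complex \<alpha> \<beta> \<sigma> y" for \<sigma> x y
    by (simp add: tess_ring_def defs plus_tess_def complex_eq_iff algebra_simps)
  show "tess_to_complex \<alpha> \<beta> \<sigma> (x \<otimes>\<^bsub>tess_ring \<alpha> \<beta>\<^esub> y)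
      = tess_to_complex \<alpha> \<beta> \<sigma> x * tess_to_complex \<alpha> \<beta> \<sigma> y" if "\<sigma> \<in> {1, - 1}" for \<sigma> x y
    using that by (auto simp: tess_ring_def defs tmult_def complex_eq_iff a(1,3) b(1,3) algebra_simps)
  show "tess_to_complex \<alpha> \<beta> \<sigma> \<one>\<^bsub>tess_ring \<alpha> \<beta>\<^esub> = 1" for \<sigma>
    by (simp add: tess_ring_def defs tone_def complex_eq_iff)
  show "x = y" if *: "\<And>\<sigma>. \<sigma> \<in> {1, - 1} \<Longrightarrow> tess_to_complex \<alpha> \<beta> \<sigma> x = tess_to_complex \<alpha> \<beta> \<sigma> y"
    for x y
  proof -
    have "tRe x + b * tJ x = tRe y + b * tJ y" "tRe x - b * tJ x = tRe y - b * tJ y"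
      "tI x + b * tK x = tI y + b * tK y" "tI x - b * tK x = tI y - b * tK y"
      using *[of 1] *[of "- 1"] a(2) by (auto simp: defs)
    then have "tRe x = tRe y" "b * tJ x = b * tJ y" "tI x = tI y" "b * tK x = b * tK y"
      by linarith+
    then show ?thesis using b(2) by (simp add: tess.expand)
  qed
  show "\<exists>x\<in>carrier (tess_ring \<alpha> \<beta>). \<forall>\<sigma>\<in>{1, - 1}. tess_to_complex \<alpha> \<beta> \<sigma> x = z \<sigma>" for z
    \<comment> \<open>Half the sum and half the difference of the prescribed images: real parts
      yield the coefficients of 1 and j, imaginary parts those of i and k, rescaled by
      \<open>a\<close> and \<open>b\<close>.\<close>
    by (rule bexI[of _ "Tess ((Re (z 1) + Re (z (- 1))) / 2) ((Im (z 1) + Im (z (- 1))) / (2 * a))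
        ((Re (z 1) - Re (z (- 1))) / (2 * b)) ((Im (z 1) - Im (z (- 1))) / (2 * a * b))"])
      (use a(2) b(2) in \<open>auto simp: tess_ring_def defs complex_eq_iff field_simps\<close>)
qed

text \<open>The \<open>n\<close>-th coordinate of the associated tessarine, with the signs of the definition of \<open>A\<^sub>n\<close>;
  every \<open>n\<close> outside \<open>{1, 2, 3}\<close> stands for \<open>4\<close>.\<close>

definition tess_eval :: "real \<Rightarrow> real \<Rightarrow> nat \<Rightarrow> tess \<Rightarrow> real" where
  "tess_eval \<alpha> \<beta> n x =
     (let s = (if n = 1 \<or> n = 3 then sqrt \<alpha> else - sqrt \<alpha>);
          t = (if n = 1 \<or> n = 2 then sqrt \<beta> else - sqrt \<beta>)
      in tRe x + tI x * s + (tJ x + tK x * s) * t)"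

definition gtess_to_complex :: "real \<Rightarrow> real \<Rightarrow> nat \<Rightarrow> gtess \<Rightarrow> complex" where
  "gtess_to_complex \<alpha> \<beta> n x = Complex (tess_eval \<alpha> \<beta> n (fst x)) (tess_eval \<alpha> \<beta> n (snd x))"

lemma ball_1_4: "(\<forall>n\<in>{1..4::nat}. P n) \<longleftrightarrow> P 1 \<and> P 2 \<and> P 3 \<and> P 4"
proof -
  have "{1..4::nat} = {1, 2, 3, 4}" by auto
  then show ?thesis by simp
qed

lemma tess_eval_linear:
  "tess_eval \<alpha> \<beta> n (x + y) = tess_eval \<alpha> \<beta> n x + tess_eval \<alpha> \<beta> n y"
  "tess_eval \<alpha> \<beta> n (x - y) = tess_eval \<alpha> \<beta> n x - tess_eval \<alpha> \<beta> n y"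
  "tess_eval \<alpha> \<beta> n (r *\<^sub>R x) = r * tess_eval \<alpha> \<beta> n x"
  "tess_eval \<alpha> \<beta> n 0 = 0"
  by (simp_all add: tess_eval_def Let_def tess_linear_defs algebra_simps)

text \<open>Whatever the signs, \<open>s\<close> and \<open>t\<close> are roots of \<alpha> and
  \<beta>, so substituting \<open>s\<close> for i, \<open>t\<close> for j and \<open>s * t\<close>
  for k respects the multiplication table.\<close>

lemma tess_eval_mult:
  assumes "\<alpha> > 0" "\<beta> > 0"
  shows "tess_eval \<alpha> \<beta> n (tmult \<alpha> \<beta> x y) = tess_eval \<alpha> \<beta> n x * tess_eval \<alpha> \<beta> n y"
proof -
  define s t where "s = (if n = 1 \<or> n = 3 then sqrt \<alpha> else - sqrt \<alpha>)"
    and "t = (if n = 1 \<or> n = 2 then sqrt \<beta> else - sqrt \<beta>)"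
  have "\<alpha> = s * s" "\<beta> = t * t" using assms by (auto simp: s_def t_def)
  then show ?thesis
    unfolding tess_eval_def s_def[symmetric] t_def[symmetric] Let_def tmult_def
    by (simp add: algebra_simps)
qed

lemma tess_eval_basis:
  "tess_eval \<alpha> \<beta> n tone = 1"
  "tess_eval \<alpha> \<beta> n ti = (if n = 1 \<or> n = 3 then sqrt \<alpha> else - sqrt \<alpha>)"
  "tess_eval \<alpha> \<beta> n tj = (if n = 1 \<or> n = 2 then sqrt \<beta> else - sqrt \<beta>)"
  by (simp_all add: tess_eval_def Let_def tone_def ti_def tj_def)

text \<open>The four evaluations run through all sign choices for the two roots, so signed sums of
  them isolate each coefficient.\<close>

lemma tess_eval_inj:
  assumes "\<alpha> > 0" "\<beta> > 0" "\<And>n. n \<in> {1..4} \<Longrightarrow> tess_eval \<alpha> \<beta> n x = tess_eval \<alpha> \<beta> n y"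
  shows "x = y"
proof -
  define s t where "s = sqrt \<alpha>" and "t = sqrt \<beta>"
  have st: "s \<noteq> 0" "t \<noteq> 0" using assms by (auto simp: s_def t_def)
  have "tess_eval \<alpha> \<beta> n x = tess_eval \<alpha> \<beta> n y" if "n \<in> {1, 2, 3, 4}" for n
    using assms(3) that by auto
  note E = this[of 1] this[of 2] this[of 3] this[of 4]
  \<comment> \<open>After expansion, the products of coefficients with \<open>s\<close> and
    \<open>t\<close> act as atoms in which the equations are linear.\<close>
  note E = E[unfolded tess_eval_def Let_def, simplified, folded s_def t_def,
    unfolded distrib_right left_diff_distrib]
  have "tRe x = tRe y" "tI x * s = tI y * s" "tJ x * t = tJ y * t"
    "tK x * s * t = tK y * s * t"
    using E by linarith+
  then show ?thesis using st by (simp add: tess.expand)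
qed

text \<open>The sign patterns form a symmetric 4 by 4 Hadamard matrix, whose square is 4 times the
  identity, so evaluating at all sign choices undoes the signed averages. The field is general
  because both real and complex instances occur.\<close>

lemma hadamard_inversion:
  fixes a b c d s t :: "'a::field_char_0"
  assumes "s \<noteq> 0" "t \<noteq> 0"
  shows "(a + b + c + d) / 4 + (a - b + c - d) / (4 * s) * s
      + ((a + b - c - d) / (4 * t) + (a - b - c + d) / (4 * s * t) * s) * t = a" (is ?A)
    and "(a + b + c + d) / 4 + (a - b + c - d) / (4 * s) * - s
      + ((a + b - c - d) / (4 * t) + (a - b - c + d) / (4 * s * t) * - s) * t = b" (is ?B)
    and "(a + b + c + d) / 4 + (a - b + c - d) / (4 * s) * s
      + ((a + b - c - d) / (4 * t) + (a - b - c + d) / (4 * s * t) * s) * - t = c" (is ?C)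
    and "(a + b + c + d) / 4 + (a - b + c - d) / (4 * s) * - s
      + ((a + b - c - d) / (4 * t) + (a - b - c + d) / (4 * s * t) * - s) * - t = d" (is ?D)
proof -
  \<comment> \<open>Once \<open>s\<close> and \<open>t\<close> cancel, the claims are linear in
    \<open>a\<close>, \<open>b\<close>, \<open>c\<close>, \<open>d\<close>.\<close>
  have cancel: "x / (4 * s) * s = x / 4" "x / (4 * s * t) * s * t = x / 4"
    "x / (4 * t) * t = x / 4" for x
    using assms by auto
  show ?A ?B ?C ?D
    unfolding distrib_right mult_minus_right mult_minus_left cancel
    by (simp_all add: add_divide_distrib diff_divide_distrib)
qed

text \<open>The formula defining association is the inverse Hadamard transform of the four
  coordinates, so evaluation recovers them.\<close>

lemma tess_eval_associated:
  assumes "\<alpha> > 0" "\<beta> > 0" "is_associated_tess \<alpha> \<beta> (Tess (z 1) (z 2) (z 3) (z 4)) x"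
    and "n \<in> {1..4}"
  shows "tess_eval \<alpha> \<beta> n x = z n"
proof -
  have "sqrt \<alpha> \<noteq> 0" "sqrt \<beta> \<noteq> 0" using assms by auto
  note H = hadamard_inversion[OF this, of "z 1" "z 2" "z 3" "z 4"]
  have "\<forall>n\<in>{1..4}. tess_eval \<alpha> \<beta> n x = z n"
    unfolding ball_1_4 tess_eval_def Let_def using assms(3) H by (simp add: is_associated_tess_def)
  then show ?thesis using assms(4) by blast
qed

text \<open>The tessarines split into four copies of the reals by \<open>tess_eval\<close>;
  adjoining \<epsilon> with square -1 turns each copy into the complex field.\<close>

lemma split_gtess_ring:
  assumes "\<alpha> > 0" "\<beta> > 0"
  shows "split_ring (gtess_ring \<alpha> \<beta>) {1..4} (gtess_to_complex \<alpha> \<beta>)"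
proof (intro split_ring.intro cring_gtess_ring split_ring_axioms.intro)
  show "gtess_to_complex \<alpha> \<beta> n (x \<oplus>\<^bsub>gtess_ring \<alpha> \<beta>\<^esub> y)
      = gtess_to_complex \<alpha> \<beta> n x + gtess_to_complex \<alpha> \<beta> n y" for n x y
    by (simp add: gtess_ring_def gtess_to_complex_def tess_eval_linear complex_eq_iff)
  show "gtess_to_complex \<alpha> \<beta> n (x \<otimes>\<^bsub>gtess_ring \<alpha> \<beta>\<^esub> y)
      = gtess_to_complex \<alpha> \<beta> n x * gtess_to_complex \<alpha> \<beta> n y" for n x y
    by (simp add: gtess_ring_def gtess_to_complex_def gmult_def tess_eval_linear
        tess_eval_mult[OF assms] complex_eq_iff)
  show "gtess_to_complex \<alpha> \<beta> n \<one>\<^bsub>gtess_ring \<alpha> \<beta>\<^esub> = 1" for n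
    by (simp add: gtess_ring_def gtess_to_complex_def tess_eval_linear tess_eval_basis
        complex_eq_iff)
  show "x = y"
    if "\<And>n. n \<in> {1..4} \<Longrightarrow> gtess_to_complex \<alpha> \<beta> n x = gtess_to_complex \<alpha> \<beta> n y" for x y
    using tess_eval_inj[OF assms, of "fst x" "fst y"] tess_eval_inj[OF assms, of "snd x" "snd y"]
      that by (auto simp: gtess_to_complex_def prod_eq_iff)
  show "\<exists>x\<in>carrier (gtess_ring \<alpha> \<beta>). \<forall>n\<in>{1..4}. gtess_to_complex \<alpha> \<beta> n x = z n" for z
  proof -
    have ex: "\<exists>x. is_associated_tess \<alpha> \<beta> (Tess (g 1) (g 2) (g 3) (g 4)) x" for g :: "nat \<Rightarrow> real"
      by (simp add: is_associated_tess_def)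
    \<comment> \<open>The preimage of \<open>z\<close> has the same form as the eigenvalues of
      \<open>X\<close>: its two components are associated with the real and the imaginary
      parts.\<close>
    obtain x y where "is_associated_tess \<alpha> \<beta> (Tess (Re (z 1)) (Re (z 2)) (Re (z 3)) (Re (z 4))) x"
      "is_associated_tess \<alpha> \<beta> (Tess (Im (z 1)) (Im (z 2)) (Im (z 3)) (Im (z 4))) y"
      using ex[of "\<lambda>n. Re (z n)"] ex[of "\<lambda>n. Im (z n)"] by auto
    then show ?thesis
      using tess_eval_associated[OF assms, of "\<lambda>n. Re (z n)" x]
        tess_eval_associated[OF assms, of "\<lambda>n. Im (z n)" y]
      by (intro bexI[of _ "(x, y)"])
        (auto simp: gtess_ring_def gtess_to_complex_def complex_eq_iff)
  qed
qed

lemma gtess_to_complex_simps: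
  assumes "\<alpha> > 0" "\<beta> > 0"
  shows "gtess_to_complex \<alpha> \<beta> n (x + y) = gtess_to_complex \<alpha> \<beta> n x + gtess_to_complex \<alpha> \<beta> n y"
    "gtess_to_complex \<alpha> \<beta> n (gmult \<alpha> \<beta> x y)
      = gtess_to_complex \<alpha> \<beta> n x * gtess_to_complex \<alpha> \<beta> n y"
    "gtess_to_complex \<alpha> \<beta> n (g_of_complex z) = z"
    "gtess_to_complex \<alpha> \<beta> n (g_of_tess a) = complex_of_real (tess_eval \<alpha> \<beta> n a)"
  by (simp_all add: gtess_to_complex_def gmult_def g_of_complex_def g_of_tess_def
      tess_eval_linear tess_eval_basis tess_eval_mult[OF assms] complex_eq_iff)

section \<open>The components of the eigenvector matrices\<close>

text \<open>\<open>lambda_neg\<close> is the half-sum plus j / sqrt \<beta> times the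
  half-difference, so setting j / sqrt \<beta> to 1 or -1 leaves the first or the second
  argument.\<close>

lemma tess_to_complex_lambda_neg:
  assumes "\<beta> > 0"
  shows "tess_to_complex \<alpha> \<beta> 1 (lambda_neg \<beta> ls ld) = acomplex_to_complex \<alpha> ls"
    and "tess_to_complex \<alpha> \<beta> (- 1) (lambda_neg \<beta> ls ld) = acomplex_to_complex \<alpha> ld"
  using assms
  by (auto simp: lambda_neg_def tess_to_complex_def acomplex_to_complex_def plus_tess_def
      minus_tess_def field_simps)

lemma map_U_neg:
  assumes "\<alpha> < 0" "\<beta> > 0"
    and "W1 \<in> carrier (matrix_ring (acomplex_ring \<alpha> \<beta>) p)"
    and "W2 \<in> carrier (matrix_ring (acomplex_ring \<alpha> \<beta>) p)"
  shows "map_mat (tess_to_complex \<alpha> \<beta> 1) (U_neg \<alpha> \<beta> p W1 W2) = map_mat (acomplex_to_complex \<alpha>) W1"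
    and "map_mat (tess_to_complex \<alpha> \<beta> (- 1)) (U_neg \<alpha> \<beta> p W1 W2)
      = map_mat (acomplex_to_complex \<alpha>) W2"
proof -
  interpret C: split_ring "acomplex_ring \<alpha> \<beta>" UNIV "\<lambda>_::unit. acomplex_to_complex \<alpha>"
    by (rule split_acomplex_ring[OF assms(1)])
  have W: "tJ (W1 $$ (i, j)) = 0" "tK (W1 $$ (i, j)) = 0" "tJ (W2 $$ (i, j)) = 0" "tK (W2 $$ (i, j)) = 0"
    if "i < p" "j < p" for i j
    using assms(3,4) that unfolding C.matrix_ring_carrier_iff by (auto simp: acomplex_ring_def)
  \<comment> \<open>As the entries of \<open>W1\<close> and \<open>W2\<close> have no j and k parts,
    \<open>U_neg\<close> combines them exactly as eigenvalues are combined.\<close>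
  have "U_neg \<alpha> \<beta> p W1 W2 $$ (i, j) = lambda_neg \<beta> (W1 $$ (i, j)) (W2 $$ (i, j))"
    if "i < p" "j < p" for i j
    using W[OF that] that by (simp add: U_neg_def lambda_neg_def tmult_def tj_def plus_tess_def
        minus_tess_def scaleR_tess_def)
  moreover have "U_neg \<alpha> \<beta> p W1 W2 \<in> carrier_mat p p" by (simp add: U_neg_def)
  moreover have "W1 \<in> carrier_mat p p" "W2 \<in> carrier_mat p p"
    using assms(3,4) by (auto simp: C.matrix_ring_carrier_iff)
  ultimately show "map_mat (tess_to_complex \<alpha> \<beta> 1) (U_neg \<alpha> \<beta> p W1 W2)
      = map_mat (acomplex_to_complex \<alpha>) W1"
    "map_mat (tess_to_complex \<alpha> \<beta> (- 1)) (U_neg \<alpha> \<beta> p W1 W2)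
      = map_mat (acomplex_to_complex \<alpha>) W2"
    by (auto intro!: eq_matI simp: tess_to_complex_lambda_neg[OF assms(2)])
qed

text \<open>Replacing j by sqrt \<beta> or its negative is how \<open>mat_s\<close> and
  \<open>mat_d\<close> arise, so they represent the two factors of \<open>X\<close>.\<close>

lemma map_mat_tess_to_complex:
  "map_mat (tess_to_complex \<alpha> \<beta> 1) X = map_mat (acomplex_to_complex \<alpha>) (mat_s \<beta> X)"
  "map_mat (tess_to_complex \<alpha> \<beta> (- 1)) X = map_mat (acomplex_to_complex \<alpha>) (mat_d \<beta> X)"
  by (auto simp: mat_s_def mat_d_def tess_to_complex_def acomplex_to_complex_def plus_tess_def
      minus_tess_def scaleR_tess_def)

text \<open>\<open>U_pos\<close> is the entrywise inverse Hadamard transform of the four matrices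
  \<open>V n\<close>.\<close>

lemma map_U_pos:
  assumes "\<alpha> > 0" "\<beta> > 0" "\<forall>n\<in>{1..4}. V n \<in> carrier_mat p p" "n \<in> {1..4}"
  shows "map_mat (gtess_to_complex \<alpha> \<beta> n) (U_pos \<alpha> \<beta> p V) = V n"
proof -
  define s t where "s = complex_of_real (sqrt \<alpha>)" and "t = complex_of_real (sqrt \<beta>)"
  have st: "s \<noteq> 0" "t \<noteq> 0" using assms by (auto simp: s_def t_def)
  \<comment> \<open>The signs of the two roots are kept as conditionals, so that one formula covers
    the four cases of \<open>hadamard_inversion\<close>.\<close>
  have entry: "gtess_to_complex \<alpha> \<beta> n (U_pos \<alpha> \<beta> p V $$ (i, j)) =
      (a + b + c + d) / 4 + (a - b + c - d) / (4 * s) * (if n = 1 \<or> n = 3 then s else - s)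
      + ((a + b - c - d) / (4 * t) + (a - b - c + d) / (4 * s * t)
        * (if n = 1 \<or> n = 3 then s else - s)) * (if n = 1 \<or> n = 2 then t else - t)"
    if "i < p" "j < p" "a = V 1 $$ (i, j)" "b = V 2 $$ (i, j)" "c = V 3 $$ (i, j)"
      "d = V 4 $$ (i, j)" for n i j a b c d
    using that(1,2) unfolding that(3-6)
    by (simp add: U_pos_def Let_def gtess_to_complex_simps[OF assms(1,2)] tess_eval_basis
        s_def t_def)
  have "\<forall>n\<in>{1..4}. \<forall>i<p. \<forall>j<p.
      gtess_to_complex \<alpha> \<beta> n (U_pos \<alpha> \<beta> p V $$ (i, j)) = V n $$ (i, j)"
    unfolding ball_1_4
    by (intro conjI allI impI; subst entry[OF _ _ refl refl refl refl];
        simp add: hadamard_inversion[OF st, simplified])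
  then have "\<forall>i<p. \<forall>j<p. gtess_to_complex \<alpha> \<beta> n (U_pos \<alpha> \<beta> p V $$ (i, j)) = V n $$ (i, j)"
    using assms(4) by blast
  moreover have "U_pos \<alpha> \<beta> p V \<in> carrier_mat p p" "V n \<in> carrier_mat p p"
    using assms(3,4) by (auto simp: U_pos_def)
  ultimately show ?thesis by (intro eq_matI) auto
qed

text \<open>Both sides replace i and j by signed roots; thus the matrices \<open>mat_A\<close> are
  the factors of \<open>X\<close> once it is embedded by \<open>g_of_tess\<close>.\<close>

lemma mat_A_eq_map_mat_tess_eval:
  assumes "n \<in> {1..4}"
  shows "mat_A \<alpha> \<beta> X n = map_mat (tess_eval \<alpha> \<beta> n) X"
proof -
  have "\<forall>n\<in>{1..4}. mat_A \<alpha> \<beta> X n = map_mat (tess_eval \<alpha> \<beta> n) X"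
    unfolding ball_1_4
    by (intro conjI eq_matI) (simp_all add: mat_A_def mat_s_def mat_d_def tess_eval_def Let_def
        plus_tess_def minus_tess_def scaleR_tess_def algebra_simps)
  then show ?thesis using assms by blast
qed

section \<open>Diagonalization for negative and for positive \<alpha>\<close>

text \<open>The eigenvalue lists come already permuted, \<open>ls i\<close> and \<open>ld i\<close>
  belonging to column \<open>i\<close>. Invertibility over the subring and over the tessarines is
  compared through the complex images.\<close>

lemma tess_diagonalization:
  assumes "\<alpha> < 0" "\<beta> > 0" and X: "X \<in> carrier_mat p p"
    and l: "\<And>i. i < p \<Longrightarrow> ls i \<in> carrier (acomplex_ring \<alpha> \<beta>)"
      "\<And>i. i < p \<Longrightarrow> ld i \<in> carrier (acomplex_ring \<alpha> \<beta>)"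
    and W: "W1 \<in> carrier (matrix_ring (acomplex_ring \<alpha> \<beta>) p)"
      "W2 \<in> carrier (matrix_ring (acomplex_ring \<alpha> \<beta>) p)"
    and e: "\<And>i. i < p \<Longrightarrow> eigenvector_over (acomplex_ring \<alpha> \<beta>) p (mat_s \<beta> X) (col W1 i) (ls i)"
      "\<And>i. i < p \<Longrightarrow> eigenvector_over (acomplex_ring \<alpha> \<beta>) p (mat_d \<beta> X) (col W2 i) (ld i)"
  defines "M \<equiv> matrix_ring (tess_ring \<alpha> \<beta>) p" and "U \<equiv> U_neg \<alpha> \<beta> p W1 W2"
  shows "U \<in> Units M \<longleftrightarrow> W1 \<in> Units (matrix_ring (acomplex_ring \<alpha> \<beta>) p) \<and>
      W2 \<in> Units (matrix_ring (acomplex_ring \<alpha> \<beta>) p)"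
    and "U \<in> Units M \<Longrightarrow> X = U \<otimes>\<^bsub>M\<^esub>
      diagonal_over (tess_ring \<alpha> \<beta>) p (\<lambda>i. lambda_neg \<beta> (ls i) (ld i)) \<otimes>\<^bsub>M\<^esub> inv\<^bsub>M\<^esub> U"
proof -
  interpret C: split_ring "acomplex_ring \<alpha> \<beta>" UNIV "\<lambda>_::unit. acomplex_to_complex \<alpha>"
    by (rule split_acomplex_ring[OF assms(1)])
  interpret T: split_ring "tess_ring \<alpha> \<beta>" "{1, - 1}" "tess_to_complex \<alpha> \<beta>"
    by (rule split_tess_ring[OF assms(1,2)])
  have closed: "Y \<in> carrier M" if "Y \<in> carrier_mat p p" for Y
    using that unfolding M_def T.matrix_ring_carrier_iff by (simp add: tess_ring_def)
  have U: "U \<in> carrier M" by (rule closed) (simp add: U_def U_neg_def)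
  note mapU = map_U_neg[OF assms(1,2) W, folded U_def]
  show "U \<in> Units M \<longleftrightarrow> W1 \<in> Units (matrix_ring (acomplex_ring \<alpha> \<beta>) p) \<and>
      W2 \<in> Units (matrix_ring (acomplex_ring \<alpha> \<beta>) p)"
    using T.matrix_ring_Units_iff[OF U[unfolded M_def]] C.matrix_ring_Units_iff[OF W(1)]
      C.matrix_ring_Units_iff[OF W(2)]
    by (simp add: M_def mapU)
  \<comment> \<open>Kept general in \<open>A\<close>, \<open>W\<close> and \<open>l\<close> to serve
    both \<open>mat_s\<close> with \<open>W1\<close> and \<open>mat_d\<close> with
    \<open>W2\<close>.\<close>
  have eig: "map_mat (acomplex_to_complex \<alpha>) A * map_mat (acomplex_to_complex \<alpha>) W
      = map_mat (acomplex_to_complex \<alpha>) W * mat_diag p (\<lambda>i. acomplex_to_complex \<alpha> (l i))"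
    if "A \<in> carrier (matrix_ring (acomplex_ring \<alpha> \<beta>) p)"
      "W \<in> carrier (matrix_ring (acomplex_ring \<alpha> \<beta>) p)"
      "\<And>i. i < p \<Longrightarrow> l i \<in> carrier (acomplex_ring \<alpha> \<beta>)"
      "\<And>i. i < p \<Longrightarrow> eigenvector_over (acomplex_ring \<alpha> \<beta>) p A (col W i) (l i)" for A W l
  proof (rule mult_mat_eigenvector_columns)
    fix i assume i: "i < p"
    have "col (map_mat (acomplex_to_complex \<alpha>) W) i = map_vec (acomplex_to_complex \<alpha>) (col W i)"
      using i that(2) by (auto simp: C.matrix_ring_carrier_iff)
    then show "map_mat (acomplex_to_complex \<alpha>) A *\<^sub>v col (map_mat (acomplex_to_complex \<alpha>) W) i
        = acomplex_to_complex \<alpha> (l i) \<cdot>\<^sub>v col (map_mat (acomplex_to_complex \<alpha>) W) i"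
      using C.map_eigenvector_over[OF UNIV_I that(1) that(3)[OF i] that(4)[OF i]] by simp
  qed (use that(1,2) C.map_mat_closed in auto)
  have sd: "mat_s \<beta> X \<in> carrier (matrix_ring (acomplex_ring \<alpha> \<beta>) p)"
    "mat_d \<beta> X \<in> carrier (matrix_ring (acomplex_ring \<alpha> \<beta>) p)"
    using X unfolding C.matrix_ring_carrier_iff
    by (auto simp: mat_s_def mat_d_def acomplex_ring_def plus_tess_def minus_tess_def
        scaleR_tess_def)
  have eqs: "map_mat (acomplex_to_complex \<alpha>) (mat_s \<beta> X) * map_mat (acomplex_to_complex \<alpha>) W1
      = map_mat (acomplex_to_complex \<alpha>) W1 * mat_diag p (\<lambda>i. acomplex_to_complex \<alpha> (ls i))"
    "map_mat (acomplex_to_complex \<alpha>) (mat_d \<beta> X) * map_mat (acomplex_to_complex \<alpha>) W2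
      = map_mat (acomplex_to_complex \<alpha>) W2 * mat_diag p (\<lambda>i. acomplex_to_complex \<alpha> (ld i))"
    by (rule eig; use sd W l e in blast)+
  assume Un: "U \<in> Units M"
  show "X = U \<otimes>\<^bsub>M\<^esub>
      diagonal_over (tess_ring \<alpha> \<beta>) p (\<lambda>i. lambda_neg \<beta> (ls i) (ld i)) \<otimes>\<^bsub>M\<^esub> inv\<^bsub>M\<^esub> U"
    unfolding M_def
  proof (rule T.matrix_ring_diagonalization)
    fix \<sigma> :: real assume "\<sigma> \<in> {1, - 1}"
    then show "map_mat (tess_to_complex \<alpha> \<beta> \<sigma>) X * map_mat (tess_to_complex \<alpha> \<beta> \<sigma>) U
        = map_mat (tess_to_complex \<alpha> \<beta> \<sigma>) U *
          mat_diag p (\<lambda>i. tess_to_complex \<alpha> \<beta> \<sigma> (lambda_neg \<beta> (ls i) (ld i)))"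
      \<comment> \<open>The component rule is instantiated at \<open>X\<close>, since in general
        form it would also rewrite the images of \<open>U\<close>, which \<open>mapU\<close> has to
        handle.\<close>
      using eqs by (auto simp only: insert_iff empty_iff mapU
          tess_to_complex_lambda_neg[OF assms(2)] map_mat_tess_to_complex[of _ _ X])
  qed (use closed[OF X] Un in \<open>auto simp: M_def tess_ring_def\<close>)
qed

text \<open>The real matrices \<open>mat_A\<close> may have complex eigenvalues, so the
  factorization takes place in the algebra with \<epsilon>, into which \<open>g_of_tess\<close>
  embeds \<open>X\<close>.\<close>

lemma gtess_diagonalization:
  assumes "\<alpha> > 0" "\<beta> > 0" and X: "X \<in> carrier_mat p p"
    and V: "\<forall>n\<in>{1..4}. V n \<in> carrier_mat p p"
    and \<phi>: "\<And>i. i < p \<Longrightarrow>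
      is_associated_tess \<alpha> \<beta> (Tess (Re (\<theta> 1 i)) (Re (\<theta> 2 i)) (Re (\<theta> 3 i)) (Re (\<theta> 4 i))) (\<phi> i)"
    and \<psi>: "\<And>i. i < p \<Longrightarrow>
      is_associated_tess \<alpha> \<beta> (Tess (Im (\<theta> 1 i)) (Im (\<theta> 2 i)) (Im (\<theta> 3 i)) (Im (\<theta> 4 i))) (\<psi> i)"
    and e: "\<And>n i. n \<in> {1..4} \<Longrightarrow> i < p \<Longrightarrow>
      eigenvector (map_mat complex_of_real (mat_A \<alpha> \<beta> X n)) (col (V n) i) (\<theta> n i)"
  defines "M \<equiv> matrix_ring (gtess_ring \<alpha> \<beta>) p" and "U \<equiv> U_pos \<alpha> \<beta> p V"
  shows "U \<in> Units M \<longleftrightarrow> (\<forall>n\<in>{1..4}. invertible_mat (V n))"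
    and "U \<in> Units M \<Longrightarrow> map_mat g_of_tess X = U \<otimes>\<^bsub>M\<^esub>
      diagonal_over (gtess_ring \<alpha> \<beta>) p (\<lambda>i. (\<phi> i, \<psi> i)) \<otimes>\<^bsub>M\<^esub> inv\<^bsub>M\<^esub> U"
proof -
  interpret G: split_ring "gtess_ring \<alpha> \<beta>" "{1..4}" "gtess_to_complex \<alpha> \<beta>"
    by (rule split_gtess_ring[OF assms(1,2)])
  have closed: "Y \<in> carrier M" if "Y \<in> carrier_mat p p" for Y
    using that unfolding M_def G.matrix_ring_carrier_iff by (simp add: gtess_ring_def)
  have U: "U \<in> carrier M" by (rule closed) (simp add: U_def U_pos_def)
  note mapU = map_U_pos[OF assms(1,2) V, folded U_def]
  show "U \<in> Units M \<longleftrightarrow> (\<forall>n\<in>{1..4}. invertible_mat (V n))"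
    using G.matrix_ring_Units_iff[OF U[unfolded M_def]] by (simp add: M_def mapU)
  assume Un: "U \<in> Units M"
  show "map_mat g_of_tess X = U \<otimes>\<^bsub>M\<^esub>
      diagonal_over (gtess_ring \<alpha> \<beta>) p (\<lambda>i. (\<phi> i, \<psi> i)) \<otimes>\<^bsub>M\<^esub> inv\<^bsub>M\<^esub> U"
    unfolding M_def
  proof (rule G.matrix_ring_diagonalization)
    fix n :: nat assume n: "n \<in> {1..4}"
    have ev: "gtess_to_complex \<alpha> \<beta> n (\<phi> i, \<psi> i) = \<theta> n i" if "i < p" for i
      using tess_eval_associated[OF assms(1,2), of "\<lambda>n. Re (\<theta> n i)" "\<phi> i", OF \<phi>[OF that] n]
        tess_eval_associated[OF assms(1,2), of "\<lambda>n. Im (\<theta> n i)" "\<psi> i", OF \<psi>[OF that] n]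
      by (simp add: gtess_to_complex_def)
    have mapX: "map_mat (gtess_to_complex \<alpha> \<beta> n) (map_mat g_of_tess X)
        = map_mat complex_of_real (mat_A \<alpha> \<beta> X n)"
      by (intro eq_matI)
        (simp_all add: mat_A_eq_map_mat_tess_eval[OF n] gtess_to_complex_simps[OF assms(1,2)])
    have "map_mat complex_of_real (mat_A \<alpha> \<beta> X n) * V n
        = V n * mat_diag p (\<lambda>i. gtess_to_complex \<alpha> \<beta> n (\<phi> i, \<psi> i))"
      by (rule mult_mat_eigenvector_columns)
        (use e[OF n] V n X in \<open>auto simp: ev eigenvector_def mat_A_def mat_s_def mat_d_def\<close>)
    then show "map_mat (gtess_to_complex \<alpha> \<beta> n) (map_mat g_of_tess X) *
          map_mat (gtess_to_complex \<alpha> \<beta> n) U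
        = map_mat (gtess_to_complex \<alpha> \<beta> n) U *
          mat_diag p (\<lambda>i. gtess_to_complex \<alpha> \<beta> n (\<phi> i, \<psi> i))"
      unfolding mapU[OF n] mapX .
  qed (use closed[of "map_mat g_of_tess X"] X Un in \<open>auto simp: M_def gtess_ring_def\<close>)
qed

theorem theorem1:
  fixes \<alpha> \<beta> :: real and p :: nat and X :: "tess mat"
  assumes "\<alpha> \<noteq> 0" and "\<beta> > 0" and "X \<in> carrier_mat p p"
  shows
    "(\<alpha> < 0 \<longrightarrow>
       (\<forall>(ls :: nat \<Rightarrow> tess) (ld :: nat \<Rightarrow> tess) \<tau>1 \<tau>2 W1 W2.
          is_acomplex_eigenvalue_list \<alpha> \<beta> p (mat_s \<beta> X) ls \<longrightarrow>
          is_acomplex_eigenvalue_list \<alpha> \<beta> p (mat_d \<beta> X) ld \<longrightarrow>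
          \<tau>1 permutes {..<p} \<longrightarrow> \<tau>2 permutes {..<p} \<longrightarrow>
          W1 \<in> carrier (matrix_ring (acomplex_ring \<alpha> \<beta>) p) \<longrightarrow>
          W2 \<in> carrier (matrix_ring (acomplex_ring \<alpha> \<beta>) p) \<longrightarrow>
          (\<forall>i<p. eigenvector_over (acomplex_ring \<alpha> \<beta>) p (mat_s \<beta> X) (col W1 i) (ls (\<tau>1 i))) \<longrightarrow>
          (\<forall>i<p. eigenvector_over (acomplex_ring \<alpha> \<beta>) p (mat_d \<beta> X) (col W2 i) (ld (\<tau>2 i))) \<longrightarrow>
          (let M = matrix_ring (tess_ring \<alpha> \<beta>) p;
               \<Lambda> = diagonal_over (tess_ring \<alpha> \<beta>) p (\<lambda>i. lambda_neg \<beta> (ls (\<tau>1 i)) (ld (\<tau>2 i)));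
               U = U_neg \<alpha> \<beta> p W1 W2
           in (U \<in> Units M \<longleftrightarrow>
                 W1 \<in> Units (matrix_ring (acomplex_ring \<alpha> \<beta>) p) \<and>
                 W2 \<in> Units (matrix_ring (acomplex_ring \<alpha> \<beta>) p)) \<and>
              (U \<in> Units M \<longrightarrow> X = U \<otimes>\<^bsub>M\<^esub> \<Lambda> \<otimes>\<^bsub>M\<^esub> inv\<^bsub>M\<^esub> U)))) \<and>
     (\<alpha> > 0 \<longrightarrow>
       (\<forall>(\<theta> :: nat \<Rightarrow> nat \<Rightarrow> complex) (\<tau> :: nat \<Rightarrow> nat \<Rightarrow> nat) (V :: nat \<Rightarrow> complex mat)
         (\<phi> :: nat \<Rightarrow> tess) (\<psi> :: nat \<Rightarrow> tess).
          (\<forall>n\<in>{1..4}. is_eigenvalue_list p (map_mat complex_of_real (mat_A \<alpha> \<beta> X n)) (\<theta> n)) \<longrightarrow>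
          (\<forall>n\<in>{1..4}. \<tau> n permutes {..<p}) \<longrightarrow>
          (\<forall>i<p. is_associated_tess \<alpha> \<beta>
             (Tess (Re (\<theta> 1 (\<tau> 1 i))) (Re (\<theta> 2 (\<tau> 2 i))) (Re (\<theta> 3 (\<tau> 3 i))) (Re (\<theta> 4 (\<tau> 4 i))))
             (\<phi> i)) \<longrightarrow>
          (\<forall>i<p. is_associated_tess \<alpha> \<beta>
             (Tess (Im (\<theta> 1 (\<tau> 1 i))) (Im (\<theta> 2 (\<tau> 2 i))) (Im (\<theta> 3 (\<tau> 3 i))) (Im (\<theta> 4 (\<tau> 4 i))))
             (\<psi> i)) \<longrightarrow>
          (\<forall>n\<in>{1..4}. V n \<in> carrier_mat p p) \<longrightarrow>
          (\<forall>n\<in>{1..4}. \<forall>i<p.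
             eigenvector (map_mat complex_of_real (mat_A \<alpha> \<beta> X n)) (col (V n) i) (\<theta> n (\<tau> n i))) \<longrightarrow>
          (let M = matrix_ring (gtess_ring \<alpha> \<beta>) p;
               \<Lambda> = diagonal_over (gtess_ring \<alpha> \<beta>) p (\<lambda>i. (\<phi> i, \<psi> i));
               U = U_pos \<alpha> \<beta> p V
           in (U \<in> Units M \<longleftrightarrow> (\<forall>n\<in>{1..4}. invertible_mat (V n))) \<and>
              (U \<in> Units M \<longrightarrow> map_mat g_of_tess X = U \<otimes>\<^bsub>M\<^esub> \<Lambda> \<otimes>\<^bsub>M\<^esub> inv\<^bsub>M\<^esub> U))))"
proof (intro conjI impI allI, goal_cases)
  case neg: (1 ls ld \<tau>1 \<tau>2 W1 W2)
  \<comment> \<open>Permuted indices stay below \<open>p\<close>, the range where the lists are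
    known to lie in \<open>acomplex_ring\<close>.\<close>
  have \<tau>: "\<tau>1 i < p" "\<tau>2 i < p" if "i < p" for i
    using that neg(4,5) permutes_in_image by fastforce+
  then have l: "\<And>i. i < p \<Longrightarrow> ls (\<tau>1 i) \<in> carrier (acomplex_ring \<alpha> \<beta>)"
    "\<And>i. i < p \<Longrightarrow> ld (\<tau>2 i) \<in> carrier (acomplex_ring \<alpha> \<beta>)"
    using neg(2,3) by (auto simp: is_acomplex_eigenvalue_list_def)
  from tess_diagonalization[where ls = "\<lambda>i. ls (\<tau>1 i)" and ld = "\<lambda>i. ld (\<tau>2 i)",
      OF neg(1) assms(2,3) l neg(6,7)] neg(8,9) show ?case
    unfolding Let_def by blast
next
  case pos: (2 \<theta> \<tau> V \<phi> \<psi>)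
  from gtess_diagonalization[OF pos(1) assms(2,3) pos(6), of "\<lambda>n i. \<theta> n (\<tau> n i)" \<phi> \<psi>] pos(4,5,7)
  show ?case unfolding Let_def by blast
qed

end
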